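(* Let $p$ be a positive even integer. Every oriented graph with at least $p+2$ vertices is $(=p)$-invertible.
   Context: For an oriented graph $D$ and $X\subseteq V(D)$, the inversion of $X$ reverses the orientation of every arc with both endpoints in $X$. A $(=p)$-inversion is the inversion of a set of exactly $p$ vertices. An oriented graph is $(=p)$-invertible if it can be made acyclic by a (finite, possibly empty) sequence of $(=p)$-inversions. *)

theory Defs
  imports "Graph_Theory.Graph_Theory"
begin

text \<open>
  Finiteness and the absence of loops are part of \<^locale>\<open>pair_digraph\<close>; an oriented graph
  additionally has at most one arc between any two vertices.
\<close>

locale oriented_graph = pair_digraph +
  assumes no_digons: "(u, v) \<in> parcs G \<Longrightarrow> (v, u) \<notin> parcs G"

definition inversion :: "'a set \<Rightarrow> 'a pair_pre_digraph \<Rightarrow> 'a pair_pre_digraph" where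
  "inversion X D =
     D\<lparr>parcs := (\<lambda>(u, v). if u \<in> X \<and> v \<in> X then (v, u) else (u, v)) ` parcs D\<rparr>"

definition acyclic_digraph :: "'a pair_pre_digraph \<Rightarrow> bool" where
  "acyclic_digraph D \<longleftrightarrow> (\<nexists>c. pre_digraph.cycle (with_proj D) c)"

text \<open>
  Inversions do not change the vertex set, so the sets to be inverted can all be required to be
  subsets of the vertex set of the initial graph.
\<close>

definition eq_invertible :: "nat \<Rightarrow> 'a pair_pre_digraph \<Rightarrow> bool" where
  "eq_invertible p D \<longleftrightarrow>
     (\<exists>Xs. (\<forall>X \<in> set Xs. X \<subseteq> pverts D \<and> card X = p) \<and> acyclic_digraph (fold inversion Xs D))"

lemma pverts_inversion [simp]: "pverts (inversion X D) = pverts D"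
  by (simp add: inversion_def)

lemma oriented_graph_inversion:
  assumes "oriented_graph D"
  shows "oriented_graph (inversion X D)"
proof -
  interpret oriented_graph D by fact
  show ?thesis
  proof
    show "finite (pverts (inversion X D))" "finite (parcs (inversion X D))"
      using pair_finite_verts pair_finite_arcs by (auto simp: inversion_def)
    show "fst e \<in> pverts (inversion X D)" "snd e \<in> pverts (inversion X D)" "fst e \<noteq> snd e"
      if "e \<in> parcs (inversion X D)" for e
      using that by (auto simp: inversion_def dest: in_arcsD1 in_arcsD2 pair_no_loops split: if_splits)
    show "(v, u) \<notin> parcs (inversion X D)" if "(u, v) \<in> parcs (inversion X D)" for u v
      using that by (auto simp: inversion_def dest: no_digons split: if_splits)
  qed
qed

lemma acyclic_digraph_iff:
  assumes "pair_wf_digraph D"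
  shows "acyclic_digraph D \<longleftrightarrow> acyclic (parcs D)"
proof -
  interpret wf_digraph "with_proj D"
    using assms by (simp add: wf_digraph_wp_iff)
  have "(\<exists>c. cycle c) \<longleftrightarrow> (\<exists>c. closed_w c)"
    using closed_w_imp_cycle cycle_altdef by blast
  also have "\<dots> \<longleftrightarrow> (\<exists>u. u \<rightarrow>\<^sup>+\<^bsub>with_proj D\<^esub> u)"
    unfolding closed_w_def reachable1_awalk by auto
  finally show ?thesis
    by (simp add: acyclic_digraph_def acyclic_def)
qed

end

theory Submission
  imports Defs
begin

text \<open>
  Modulo two, a sequence of inversions amounts to the set of vertex pairs that it flips. For sets
  of size \<open>p\<close> the cliques on \<open>Z \<union> {x}\<close> and \<open>Z \<union> {y}\<close> add up to the star-like graph \<open>{x, y} \<times> Z\<close>,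
  and two of these whose sets \<open>Z\<close> differ in one element add up to a 4-cycle; as the number of
  vertices is at least \<open>p + 2\<close>, every 4-cycle arises. Since \<open>|Z| = p - 1\<close> is odd, adding 4-cycles to
  \<open>{x, y} \<times> Z\<close> leaves a path with two edges. Such paths generate all sets of pairs of even size.
  Now fix an ordering of the vertices. Either the number of backward arcs is even, and flipping
  them makes the graph acyclic, or it becomes even after the pair of the first two vertices is
  added to or removed from them; flipping the resulting set orients all arcs forward with respect
  to the ordering with the first two vertices exchanged.
\<close>

section \<open>Sets of pairs modulo two\<close>

definition vpairs :: "'a set \<Rightarrow> 'a set set" where
  "vpairs X = {e. e \<subseteq> X \<and> card e = 2}"

text \<open>Unordered pairs are used because reversing an arc does not change \<open>{u, v}\<close>;
  successive flips then combine by symmetric difference.\<close>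

definition flip :: "'a set set \<Rightarrow> 'a pair_pre_digraph \<Rightarrow> 'a pair_pre_digraph" where
  "flip F D = D\<lparr>parcs := (\<lambda>(u, v). if {u, v} \<in> F then (v, u) else (u, v)) ` parcs D\<rparr>"

text \<open>The span over GF(2) of the cliques on \<open>p\<close>-subsets of \<open>V\<close>.
  Adding one generator at a time lets each derivation be read as a list of inversions.\<close>

inductive_set inversion_span :: "nat \<Rightarrow> 'a set \<Rightarrow> 'a set set set" for p V where
  empty: "{} \<in> inversion_span p V"
| step: "F \<in> inversion_span p V \<Longrightarrow> X \<subseteq> V \<Longrightarrow> card X = p \<Longrightarrow>
    sym_diff F (vpairs X) \<in> inversion_span p V"

text \<open>For distinct \<open>x\<close>, \<open>y\<close> outside \<open>Z\<close> these are the
  edges of a complete bipartite graph: a 4-cycle if \<open>Z\<close> has two elements, a path with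
  middle vertex \<open>z\<close> if \<open>Z = {z}\<close>.\<close>

definition double_star :: "'a \<Rightarrow> 'a \<Rightarrow> 'a set \<Rightarrow> 'a set set" where
  "double_star x y Z = (\<lambda>(u, z). {u, z}) ` ({x, y} \<times> Z)"

lemma doubleton_in_vpairs_iff: "{u, v} \<in> vpairs X \<longleftrightarrow> u \<in> X \<and> v \<in> X \<and> u \<noteq> v"
  by (auto simp: vpairs_def card_2_iff doubleton_eq_iff)

lemma vpairs_insert: "x \<notin> X \<Longrightarrow> vpairs (insert x X) = vpairs X \<union> (\<lambda>z. {x, z}) ` X"
  by (auto simp: vpairs_def card_2_iff doubleton_eq_iff)

lemma sym_diff_assoc: "sym_diff (sym_diff A B) C = sym_diff A (sym_diff B C)"
  by blast

lemma inversion_span_sym_diff: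
  assumes "F \<in> inversion_span p V" "G \<in> inversion_span p V"
  shows "sym_diff F G \<in> inversion_span p V"
  using assms(2)
proof induction
  case empty
  then show ?case using assms(1) by simp
next
  case (step G X)
  then show ?case
    using inversion_span.step[OF step.IH step.hyps(2,3)] by (simp only: sym_diff_assoc)
qed

lemma vpairs_in_inversion_span:
  assumes "X \<subseteq> V" "card X = p"
  shows "vpairs X \<in> inversion_span p V"
  using inversion_span.step[OF inversion_span.empty assms] by simp

text \<open>Serves to sum generators that contribute two elements at a time: first 4-cycles through
  fixed \<open>x\<close> and \<open>y\<close>, later two-element sets of pairs.\<close>

lemma finite_even_induct [consumes 2, case_names empty insert2]:
  assumes "finite A" "even (card A)"
    and "P {}"
    and "\<And>x y A. finite A \<Longrightarrow> even (card A) \<Longrightarrow> x \<notin> A \<Longrightarrow> y \<notin> A \<Longrightarrow> x \<noteq> y \<Longrightarrow> P A \<Longrightarrow>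
      P (insert x (insert y A))"
  shows "P A"
  using assms(1,2)
proof (induction A rule: finite_psubset_induct)
  case (psubset A)
  show ?case
  proof (cases "A = {}")
    case False
    then obtain x where x: "x \<in> A" by blast
    have "A \<noteq> {x}" using psubset.prems by auto
    with x obtain y where y: "y \<in> A" "y \<noteq> x" by blast
    define B where "B = A - {x, y}"
    have A: "A = insert x (insert y B)" "x \<notin> B" "y \<notin> B" "finite B"
      using x y psubset.hyps by (auto simp: B_def)
    have "even (card B)" using psubset.prems A y by simp
    moreover have "B \<subset> A" using A by blast
    ultimately show ?thesis
      using A y psubset.IH assms(4) by metis
  qed (simp add: assms(3))
qed

section \<open>Double stars, 4-cycles and paths in the span\<close>

lemma double_star_sym_diff:
  assumes "Z \<subseteq> - {x, y}" "W \<subseteq> - {x, y}"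
  shows "sym_diff (double_star x y Z) (double_star x y W) = double_star x y (sym_diff Z W)"
proof -
  \<comment> \<open>Exactly one end of each edge lies in \<open>{x, y}\<close>, so the edge
    determines the ordered pair; hence images commute with set difference.\<close>
  have inj: "inj_on (\<lambda>(u, z). {u, z}) ({x, y} \<times> - {x, y})"
    by (rule inj_onI) (auto simp: doubleton_eq_iff)
  have diff: "double_star x y (A - B) = double_star x y A - double_star x y B"
    if "A \<subseteq> - {x, y}" "B \<subseteq> - {x, y}" for A B
    unfolding double_star_def Sigma_Diff_distrib2
    using that by (intro inj_on_image_set_diff[OF inj]) auto
  have "double_star x y (A \<union> B) = double_star x y A \<union> double_star x y B" for A B
    unfolding double_star_def by blast
  then show ?thesis
    using diff assms by simp
qed

text \<open>The cliques on \<open>insert x Z\<close> and \<open>insert y Z\<close> share exactly the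
  pairs inside \<open>Z\<close>, which cancel; \<open>{x, y}\<close> occurs in neither.\<close>

lemma double_star_in_inversion_span:
  assumes "finite V" "Suc (card Z) = p" "Z \<subseteq> V" "x \<in> V - Z" "y \<in> V - Z" "x \<noteq> y"
  shows "double_star x y Z \<in> inversion_span p V"
proof -
  have "finite Z" using assms finite_subset by blast
  then have "vpairs (insert x Z) \<in> inversion_span p V" "vpairs (insert y Z) \<in> inversion_span p V"
    using assms by (auto intro!: vpairs_in_inversion_span)
  moreover have "sym_diff (vpairs (insert x Z)) (vpairs (insert y Z)) = double_star x y Z"
  proof -
    have "vpairs Z \<inter> (\<lambda>z. {u, z}) ` Z = {}" if "u \<notin> Z" for u
      using that by (auto simp: doubleton_in_vpairs_iff)
    moreover have "(\<lambda>z. {x, z}) ` Z \<inter> (\<lambda>z. {y, z}) ` Z = {}"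
      using assms(4-6) by (auto simp: doubleton_eq_iff)
    moreover have "double_star x y Z = (\<lambda>z. {x, z}) ` Z \<union> (\<lambda>z. {y, z}) ` Z"
      by (auto simp: double_star_def)
    ultimately show ?thesis
      using assms(4,5) by (simp add: vpairs_insert) blast
  qed
  ultimately show ?thesis
    using inversion_span_sym_diff by metis
qed

lemma four_cycle_in_inversion_span:
  assumes "finite V" "p \<ge> 2" "card V \<ge> p + 2"
    and "{x, y, z, w} \<subseteq> V" "distinct [x, y, z, w]"
  shows "double_star x y {z, w} \<in> inversion_span p V"
proof -
  \<comment> \<open>The bound \<open>p + 2\<close> leaves room for \<open>p - 2\<close> vertices
    besides these four; \<open>z\<close> or \<open>w\<close> completes them to a set of size
    \<open>p - 1\<close>.\<close>
  have "card (V - {x, y, z, w}) \<ge> p - 2"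
    using assms by (subst card_Diff_subset) auto
  then obtain Y where Y: "Y \<subseteq> V - {x, y, z, w}" "card Y = p - 2"
    using obtain_subset_with_card_n by metis
  then have "finite Y" using assms(1) finite_subset by blast
  have "double_star x y (insert z Y) \<in> inversion_span p V"
    "double_star x y (insert w Y) \<in> inversion_span p V"
    using assms Y \<open>finite Y\<close> by (auto intro!: double_star_in_inversion_span simp: card_insert_if)
  moreover have "sym_diff (double_star x y (insert z Y)) (double_star x y (insert w Y)) =
      double_star x y {z, w}"
    using assms(5) Y(1)
    by (subst double_star_sym_diff) (auto intro!: arg_cong[where f = "double_star x y"])
  ultimately show ?thesis
    using inversion_span_sym_diff by metis
qed

lemma even_double_star_in_inversion_span:
  assumes "finite V" "p \<ge> 2" "card V \<ge> p + 2" "x \<in> V" "y \<in> V" "x \<noteq> y"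
    and "finite Z" "even (card Z)" "Z \<subseteq> V - {x, y}"
  shows "double_star x y Z \<in> inversion_span p V"
  using assms(7-9)
proof (induction Z rule: finite_even_induct)
  case empty
  then show ?case by (simp add: double_star_def inversion_span.empty)
next
  case (insert2 z w Z)
  have "double_star x y {z, w} \<in> inversion_span p V"
    using insert2 assms(1-6) by (intro four_cycle_in_inversion_span) auto
  moreover have "double_star x y Z \<in> inversion_span p V" using insert2 by auto
  moreover have "sym_diff (double_star x y {z, w}) (double_star x y Z) =
      double_star x y (insert z (insert w Z))"
    using insert2
    by (subst double_star_sym_diff) (auto intro!: arg_cong[where f = "double_star x y"])
  ultimately show ?case
    using inversion_span_sym_diff by metis
qed

text \<open>The parity of \<open>p\<close> enters here: \<open>Y\<close> has even size
  \<open>p - 2\<close>, so 4-cycles cancel its part of the double star on \<open>insert z Y\<close>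
  and only \<open>z\<close> remains.\<close>

lemma path_in_inversion_span:
  assumes "finite V" "p > 0" "even p" "card V \<ge> p + 2"
    and "{x, y, z} \<subseteq> V" "distinct [x, y, z]"
  shows "{{x, z}, {y, z}} \<in> inversion_span p V"
proof -
  have p: "p \<ge> 2" using assms(2,3) by (cases "p = 1") auto
  have "card (V - {x, y, z}) \<ge> p - 2"
    using assms by (subst card_Diff_subset) auto
  then obtain Y where Y: "Y \<subseteq> V - {x, y, z}" "card Y = p - 2"
    using obtain_subset_with_card_n by metis
  then have "finite Y" using assms(1) finite_subset by blast
  have "double_star x y (insert z Y) \<in> inversion_span p V"
    using assms p Y \<open>finite Y\<close> by (auto intro!: double_star_in_inversion_span simp: card_insert_if)
  moreover have "double_star x y Y \<in> inversion_span p V"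
    using assms p Y \<open>finite Y\<close> by (intro even_double_star_in_inversion_span) auto
  moreover have "sym_diff (double_star x y (insert z Y)) (double_star x y Y) = double_star x y {z}"
    using assms(6) Y(1)
    by (subst double_star_sym_diff) (auto intro!: arg_cong[where f = "double_star x y"])
  moreover have "double_star x y {z} = {{x, z}, {y, z}}"
    by (auto simp: double_star_def)
  ultimately show ?thesis
    using inversion_span_sym_diff by metis
qed

section \<open>All even sets of pairs\<close>

lemma two_vpairs_in_inversion_span:
  assumes "finite V" "p > 0" "even p" "card V \<ge> p + 2"
    and "e \<in> vpairs V" "f \<in> vpairs V" "e \<noteq> f"
  shows "{e, f} \<in> inversion_span p V"
proof -
  note path = path_in_inversion_span[OF assms(1-4)]
  obtain a b where e: "e = {a, b}" "a \<noteq> b" "a \<in> V" "b \<in> V"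
    using assms(5) by (auto simp: vpairs_def card_2_iff)
  obtain c d where f: "f = {c, d}" "c \<noteq> d" "c \<in> V" "d \<in> V"
    using assms(6) by (auto simp: vpairs_def card_2_iff)
  consider "a = c" | "a = d" | "b = c" | "b = d" | "distinct [a, b, c, d]"
    using e f by auto
  then show ?thesis
  proof cases
    case 1 then show ?thesis using path[of b d a] e f assms(7) by (auto simp: insert_commute)
  next
    case 2 then show ?thesis using path[of b c a] e f assms(7) by (auto simp: insert_commute)
  next
    case 3 then show ?thesis using path[of a d b] e f assms(7) by (auto simp: insert_commute)
  next
    case 4 then show ?thesis using path[of a c b] e f assms(7) by (auto simp: insert_commute)
  next
    case 5
    \<comment> \<open>Disjoint pairs are linked by \<open>{b, c}\<close>, which lies in both paths
      and cancels.\<close>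
    have "{{a, b}, {c, b}} \<in> inversion_span p V" "{{b, c}, {d, c}} \<in> inversion_span p V"
      using path[of a c b] path[of b d c] 5 e f by auto
    moreover have "sym_diff {{a, b}, {c, b}} {{b, c}, {d, c}} = {e, f}"
      using 5 e f by (auto simp: doubleton_eq_iff)
    ultimately show ?thesis
      using inversion_span_sym_diff by metis
  qed
qed

lemma even_in_inversion_span:
  assumes "finite V" "p > 0" "even p" "card V \<ge> p + 2"
    and "finite F" "even (card F)" "F \<subseteq> vpairs V"
  shows "F \<in> inversion_span p V"
  using assms(5-7)
proof (induction F rule: finite_even_induct)
  case empty
  then show ?case by (simp add: inversion_span.empty)
next
  case (insert2 e f F)
  have "{e, f} \<in> inversion_span p V"
    using insert2 assms(1-4) by (intro two_vpairs_in_inversion_span) auto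
  moreover have "F \<in> inversion_span p V" using insert2 by auto
  moreover have "sym_diff {e, f} F = insert e (insert f F)"
    using insert2 by auto
  ultimately show ?case
    using inversion_span_sym_diff by metis
qed

section \<open>From sets of pairs back to inversions\<close>

lemma inversion_flip:
  assumes "pair_digraph D"
  shows "inversion X (flip F D) = flip (sym_diff F (vpairs X)) D"
proof -
  interpret pair_digraph D by fact
  \<comment> \<open>An arc ends up reversed iff exactly one of the two operations reverses
    it.\<close>
  have "(case case e of (u, v) \<Rightarrow> if {u, v} \<in> F then (v, u) else (u, v) of
          (u, v) \<Rightarrow> if u \<in> X \<and> v \<in> X then (v, u) else (u, v)) =
        (case e of (u, v) \<Rightarrow> if {u, v} \<in> sym_diff F (vpairs X) then (v, u) else (u, v))"
    if "e \<in> parcs D" for e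
    using pair_no_loops[OF that] by (cases e) (auto simp: doubleton_in_vpairs_iff)
  then show ?thesis
    by (simp add: inversion_def flip_def image_image cong: image_cong)
qed

lemma inversion_span_imp_fold_inversion:
  assumes "pair_digraph D" "F \<in> inversion_span p V"
  shows "\<exists>Xs. (\<forall>X \<in> set Xs. X \<subseteq> V \<and> card X = p) \<and> fold inversion Xs D = flip F D"
  using assms(2)
proof induction
  case empty
  have "flip {} D = D" by (simp add: flip_def)
  then show ?case by (intro exI[of _ "[]"]) simp
next
  case (step F X)
  then obtain Xs where "\<forall>X \<in> set Xs. X \<subseteq> V \<and> card X = p" "fold inversion Xs D = flip F D"
    by blast
  with step show ?case
    by (intro exI[of _ "Xs @ [X]"]) (simp add: inversion_flip[OF assms(1)])
qed

lemma eq_invertible_if_flip_increasing: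
  fixes g :: "'a \<Rightarrow> nat"
  assumes "pair_digraph D" "F \<in> inversion_span p (pverts D)"
    and incr: "\<And>u v. (u, v) \<in> parcs D \<Longrightarrow> if {u, v} \<in> F then g v < g u else g u < g v"
  shows "eq_invertible p D"
proof -
  interpret pair_digraph D by fact
  have "parcs (flip F D) \<subseteq> measure g"
    using incr by (force simp: flip_def split: if_splits)
  then have "acyclic (parcs (flip F D))"
    using wf_acyclic wf_measure acyclic_subset by metis
  moreover have "pair_wf_digraph (flip F D)"
    by unfold_locales (auto simp: flip_def dest: in_arcsD1 in_arcsD2 split: if_splits)
  ultimately have "acyclic_digraph (flip F D)"
    by (simp add: acyclic_digraph_iff)
  then show ?thesis
    using inversion_span_imp_fold_inversion[OF assms(1,2)] unfolding eq_invertible_def by metis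
qed

theorem theorem1p5:
  fixes p :: nat and D :: "'a pair_pre_digraph"
  assumes "p > 0" and "even p"
    and "oriented_graph D"
    and "card (pverts D) \<ge> p + 2"
  shows "eq_invertible p D"
proof -
  interpret oriented_graph D by fact
  have pd: "pair_digraph D" by unfold_locales
  define V where "V = pverts D"
  have V: "finite V" "card V \<ge> p + 2" using assms(4) by (auto simp: V_def)
  obtain f where f: "bij_betw f V {0..<card V}"
    using ex_bij_betw_finite_nat[OF V(1)] by blast
  define B where "B = {{u, v} | u v. (u, v) \<in> parcs D \<and> f v < f u}"
  \<comment> \<open>Without digons, \<open>{u, v}\<close> can enter \<open>B\<close> only through
    the arc \<open>(u, v)\<close> itself.\<close>
  have B_iff: "{u, v} \<in> B \<longleftrightarrow> f v < f u" if "(u, v) \<in> parcs D" for u v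
    using that no_digons by (auto simp: B_def doubleton_eq_iff)
  have f_neq: "f u \<noteq> f v" if "(u, v) \<in> parcs D" for u v
    using that f pair_no_loops[OF that]
    by (auto simp: V_def bij_betw_def inj_on_def dest: in_arcsD1 in_arcsD2)
  have B_sub: "B \<subseteq> vpairs V"
    by (auto simp: B_def V_def doubleton_in_vpairs_iff dest: in_arcsD1 in_arcsD2)
  have "finite (vpairs V)"
    using V(1) by (simp add: vpairs_def)
  with B_sub have finB: "finite B" using finite_subset by blast
  note even_span = even_in_inversion_span[OF V(1) assms(1,2) V(2)]
  show ?thesis
  proof (cases "even (card B)")
    case True
    then have "B \<in> inversion_span p V" using finB B_sub by (intro even_span)
    moreover have "if {u, v} \<in> B then f v < f u else f u < f v" if "(u, v) \<in> parcs D" for u v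
      using B_iff[OF that] f_neq[OF that] by simp
    ultimately show ?thesis
      using pd unfolding V_def by (intro eq_invertible_if_flip_increasing[where g = f and F = B])
  next
    case False
    have "0 \<in> f ` V" "1 \<in> f ` V"
      using f V(2) by (auto simp: bij_betw_def)
    then obtain a b where ab: "a \<in> V" "b \<in> V" "f a = 0" "f b = 1"
      by (metis imageE)
    then have "a \<noteq> b" by auto
    \<comment> \<open>If \<open>a\<close> and \<open>b\<close> are not adjacent, toggling
      \<open>{a, b}\<close> affects no arc and only corrects the parity.\<close>
    define C where "C = sym_diff B {{a, b}}"
    have "even (card C)"
    proof (cases "{a, b} \<in> B")
      case True
      then have "C = B - {{a, b}}" by (auto simp: C_def)
      then show ?thesis using True False finB by (simp add: card_Diff_singleton)
    next
      case notin: False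
      then have "C = insert {a, b} B" by (auto simp: C_def)
      then show ?thesis using notin False finB by simp
    qed
    moreover have "finite C" using finB by (simp add: C_def)
    moreover have "C \<subseteq> vpairs V"
      using B_sub ab \<open>a \<noteq> b\<close> by (auto simp: C_def doubleton_in_vpairs_iff)
    ultimately have C: "C \<in> inversion_span p V" by (intro even_span)
    define g where "g = f(a := 1, b := 0)"
    have inj: "u = v" if "f u = f v" "u \<in> V" "v \<in> V" for u v
      using f that by (auto simp: bij_betw_def inj_on_def)
    have "if {u, v} \<in> C then g v < g u else g u < g v" if uv: "(u, v) \<in> parcs D" for u v
    proof -
      have uvV: "u \<in> V" "v \<in> V" using uv by (auto simp: V_def dest: in_arcsD1 in_arcsD2)
      \<comment> \<open>All other values exceed 1, so exchanging the values 0 and 1 reverses the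
        comparison of \<open>a\<close> with \<open>b\<close> and no other.\<close>
      have large: "f w > 1" if "w \<in> V" "w \<noteq> a" "w \<noteq> b" for w
        using inj[of w a] inj[of w b] that ab by (cases "f w = 0"; cases "f w = 1") auto
      have "g u < g v \<longleftrightarrow> (f u < f v \<longleftrightarrow> {u, v} \<noteq> {a, b})"
        using large[OF uvV(1)] large[OF uvV(2)] ab \<open>a \<noteq> b\<close> pair_no_loops[OF uv]
        by (cases "u = a"; cases "u = b"; cases "v = a"; cases "v = b")
           (auto simp: g_def doubleton_eq_iff)
      moreover have "g u \<noteq> g v"
        using large[OF uvV(1)] large[OF uvV(2)] ab \<open>a \<noteq> b\<close> pair_no_loops[OF uv] f_neq[OF uv]
        by (cases "u = a"; cases "u = b"; cases "v = a"; cases "v = b")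
           (auto simp: g_def)
      ultimately show ?thesis
        using B_iff[OF uv] f_neq[OF uv] by (auto simp: C_def)
    qed
    then show ?thesis
      using pd C unfolding V_def
      by (intro eq_invertible_if_flip_increasing[where g = g and F = C])
  qed
qed

end
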